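(* Let $S=(V,\mathcal{H})$ be a boolean representable simplicial complex which is a near-matroid, and let $k\geq 1$. Then (i) $T_k(S)$ is boolean representable; and (ii) $\mathrm{pure}(T_k(S))$ is boolean representable.
   Context: A (finite) simplicial complex is a pair $S=(V,\mathcal{H})$ where $V$ is a finite nonempty set and $\mathcal{H}\subseteq 2^V$ contains all singletons and is closed under taking subsets; maximal faces are facets. Its dimension $d$ is $\max\{|I|:I\in\mathcal{H}\}-1$. $P_n(V)$ (resp. $P_{\leq n}(V)$) is the set of subsets of $V$ of size exactly (resp. at most) $n$. A flat of $S$ is $X\subseteq V$ with $I\cup\{p\}\in\mathcal{H}$ for all $I\in\mathcal{H}\cap 2^X$, $p\in V\setminus X$; the closure $\overline{X}$ of $X\subseteq V$ is the intersection of all flats containing $X$. $S$ is a near-matroid if for all $X,Y\in\mathcal{H}$, $\overline{X}=\overline{Y}\subsetneq V$ implies $|X|=|Y|$. $S$ is boolean representable if there is a boolean matrix $M$ with columns indexed by $V$ such that $\mathcal{H}$ is exactly the set of $X\subseteq V$ for which some square submatrix with column set $X$ is congruent (by permuting rows and columns) to a lower unitriangular boolean matrix. For $k\geq 1$, $T_k(S)=(V,\mathcal{H}\cap P_{\leq k}(V))$. The pure core of $S$ is $\mathrm{pure}(S)=(V',\mathcal{H}')$ where $V'=\bigcup(\mathcal{H}\cap P_{d+1}(V))$ and $\mathcal{H}'=\bigcup\{2^X : X\in\mathcal{H}\cap P_{d+1}(V)\}$ (the largest pure subcomplex). *)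

theory Defs
  imports Main
begin

text \<open>A candidate complex is a pair \<open>(V, H)\<close> of a vertex set and a family of faces.\<close>

type_synonym 'a scomplex = "'a set \<times> 'a set set"

abbreviation vertices :: "'a scomplex \<Rightarrow> 'a set" where
  "vertices S \<equiv> fst S"

abbreviation faces :: "'a scomplex \<Rightarrow> 'a set set" where
  "faces S \<equiv> snd S"

definition simplicial_complex :: "'a scomplex \<Rightarrow> bool" where
  "simplicial_complex S \<longleftrightarrow>
     finite (vertices S) \<and> vertices S \<noteq> {} \<and>
     faces S \<subseteq> Pow (vertices S) \<and>
     (\<forall>v\<in>vertices S. {v} \<in> faces S) \<and>
     (\<forall>X\<in>faces S. \<forall>Y. Y \<subseteq> X \<longrightarrow> Y \<in> faces S)"

text \<open>Subsets of size exactly \<open>n\<close> and at most \<open>n\<close>; \<open>V\<close> is always finite where these are used.\<close>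

definition subsets_eq :: "nat \<Rightarrow> 'a set \<Rightarrow> 'a set set" where
  "subsets_eq n V = {X. X \<subseteq> V \<and> card X = n}"

definition subsets_le :: "nat \<Rightarrow> 'a set \<Rightarrow> 'a set set" where
  "subsets_le n V = {X. X \<subseteq> V \<and> card X \<le> n}"

text \<open>Natural subtraction is harmless: a simplicial complex has a nonempty vertex set and all
  singletons as faces, so the maximum is at least 1.\<close>

definition dimension :: "'a scomplex \<Rightarrow> nat" where
  "dimension S = Max (card ` faces S) - 1"

definition is_flat :: "'a scomplex \<Rightarrow> 'a set \<Rightarrow> bool" where
  "is_flat S X \<longleftrightarrow> X \<subseteq> vertices S \<and>
     (\<forall>I \<in> faces S \<inter> Pow X. \<forall>p \<in> vertices S - X. I \<union> {p} \<in> faces S)"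

text \<open>For \<open>X \<subseteq> vertices S\<close> the intersection is over a nonempty family, since
  \<open>vertices S\<close> is itself a flat.\<close>

definition flat_closure :: "'a scomplex \<Rightarrow> 'a set \<Rightarrow> 'a set" where
  "flat_closure S X = \<Inter> {F. is_flat S F \<and> X \<subseteq> F}"

definition near_matroid :: "'a scomplex \<Rightarrow> bool" where
  "near_matroid S \<longleftrightarrow>
     (\<forall>X\<in>faces S. \<forall>Y\<in>faces S.
        flat_closure S X = flat_closure S Y \<and> flat_closure S Y \<subset> vertices S
          \<longrightarrow> card X = card Y)"

text \<open>Entries below the diagonal are unconstrained.\<close>

definition lower_unitriangular :: "nat \<Rightarrow> (nat \<Rightarrow> nat \<Rightarrow> bool) \<Rightarrow> bool" where
  "lower_unitriangular n A \<longleftrightarrow>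
     (\<forall>i<n. A i i) \<and> (\<forall>i<n. \<forall>j<n. i < j \<longrightarrow> \<not> A i j)"

text \<open>The submatrix of \<open>M\<close> with row set \<open>R\<close> and column set \<open>X\<close> is square and can be brought to
  lower unitriangular form by permuting rows and columns: a permutation of the rows
  (columns) is an enumeration \<open>r\<close> of \<open>R\<close> (\<open>c\<close> of \<open>X\<close>). The empty submatrix qualifies.\<close>

definition congruent_unitriangular ::
    "('r \<Rightarrow> 'a \<Rightarrow> bool) \<Rightarrow> 'r set \<Rightarrow> 'a set \<Rightarrow> bool" where
  "congruent_unitriangular M R X \<longleftrightarrow>
     (\<exists>n r c. bij_betw r {..<n} R \<and> bij_betw c {..<n} X \<and>
        lower_unitriangular n (\<lambda>i j. M (r i) (c j)))"

text \<open>\<open>M\<close> is a boolean matrix with \<open>m\<close> rows, indexed by \<open>{..<m}\<close>, and columns indexed by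
  \<open>vertices S\<close>; its values elsewhere are irrelevant.\<close>

definition boolean_representable :: "'a scomplex \<Rightarrow> bool" where
  "boolean_representable S \<longleftrightarrow> simplicial_complex S \<and>
     (\<exists>(m::nat) (M :: nat \<Rightarrow> 'a \<Rightarrow> bool).
        faces S = {X. X \<subseteq> vertices S \<and> (\<exists>R \<subseteq> {..<m}. congruent_unitriangular M R X)})"

definition truncation :: "nat \<Rightarrow> 'a scomplex \<Rightarrow> 'a scomplex" where
  "truncation k S = (vertices S, faces S \<inter> subsets_le k (vertices S))"

definition pure_core :: "'a scomplex \<Rightarrow> 'a scomplex" where
  "pure_core S =
     (let F = faces S \<inter> subsets_eq (dimension S + 1) (vertices S)
      in (\<Union> F, \<Union> (Pow ` F)))"

end

theory Submission imports Defs begin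

text \<open>
  A complex is boolean representable iff every nonempty face \<open>X\<close> has an element \<open>x\<close> and a flat
  containing \<open>X - {x}\<close> but not \<open>x\<close>: the zero sets of the rows of a representing matrix are flats,
  and conversely the complements of all flats can serve as rows.

  In a near-matroid, all maximal faces inside a proper flat \<open>closure Y\<close> (with \<open>Y\<close> a face) have
  closure equal to that flat, hence have size \<open>card Y\<close>. For the truncation, this bound makes
  \<open>closure (X - {x})\<close> a flat of the truncation. For the pure core, let the maximal face size be
  \<open>m\<close> and let \<open>G\<close> be a proper flat that is the closure of a face of size \<open>m - 1\<close>. If \<open>F \<subseteq> G\<close> is a
  flat, \<open>I \<subseteq> F\<close> a face and \<open>p\<close> a vertex outside \<open>F\<close>, then \<open>I \<union> {p}\<close> lies in a face of size \<open>m\<close>: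
  if \<open>p \<in> G\<close>, extend \<open>I \<union> {p}\<close> to size \<open>m - 1\<close> inside \<open>G\<close> and add any vertex outside \<open>G\<close>;
  otherwise extend \<open>I\<close> to size \<open>m - 1\<close> inside \<open>G\<close> and add \<open>p\<close>.
\<close>

section \<open>Adding and removing the first row and column of a triangular submatrix\<close>

lemma congruent_unitriangular_finite:
  "congruent_unitriangular M R X \<Longrightarrow> finite X"
  unfolding congruent_unitriangular_def by (metis bij_betw_finite finite_lessThan)

lemma congruent_unitriangular_empty: "congruent_unitriangular M {} {}"
  unfolding congruent_unitriangular_def lower_unitriangular_def
  by (rule exI[of _ 0]) (simp add: bij_betw_def)

text \<open>Shifting the old indices by one frees index 0 for a new first row or column.\<close>

lemma bij_betw_case_nat:
  assumes "bij_betw f {..<n} A" and "a \<notin> A"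
  shows "bij_betw (case_nat a f) {..<Suc n} (insert a A)"
proof -
  have "case_nat a f ` {..<Suc n} = insert a (f ` {..<n})"
    unfolding lessThan_Suc_eq_insert_0 by (simp add: image_image)
  moreover have "inj_on (case_nat a f) {..<Suc n}"
    using assms unfolding bij_betw_def inj_on_def by (auto split: nat.splits)
  ultimately show ?thesis
    using assms unfolding bij_betw_def by simp
qed

lemma bij_betw_Suc_remove:
  assumes "bij_betw f {..<Suc n} A"
  shows "bij_betw (\<lambda>i. f (Suc i)) {..<n} (A - {f 0})"
proof -
  have inj: "inj_on f {..<Suc n}" and im: "f ` {..<Suc n} = A"
    using assms unfolding bij_betw_def by auto
  have "A = insert (f 0) ((\<lambda>i. f (Suc i)) ` {..<n})"
    using im unfolding lessThan_Suc_eq_insert_0 by (simp add: image_image)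
  moreover have "f 0 \<noteq> f (Suc i)" if "i < n" for i
    using inj_onD[OF inj, of 0 "Suc i"] that by auto
  moreover have "inj_on (\<lambda>i. f (Suc i)) {..<n}"
    using inj by (auto simp: inj_on_def)
  ultimately show ?thesis
    unfolding bij_betw_def by (metis Diff_insert_absorb imageE lessThan_iff)
qed

text \<open>Row \<open>q\<close> and column \<open>x\<close> are placed first. Row \<open>q\<close>
  is zero to the right of the diagonal, while the entries of column \<open>x\<close> in the old rows
  fall below the diagonal and are unconstrained.\<close>

lemma congruent_unitriangular_insert:
  assumes "congruent_unitriangular M R X" "M q x" "\<forall>y\<in>X. \<not> M q y"
  shows "congruent_unitriangular M (insert q R) (insert x X)"
proof -
  obtain n r c where r: "bij_betw r {..<n} R" and c: "bij_betw c {..<n} X"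
    and tri: "lower_unitriangular n (\<lambda>i j. M (r i) (c j))"
    using assms(1) unfolding congruent_unitriangular_def by blast
  have zero: "\<not> M q (c i)" if "i < n" for i
    using c assms(3) that by (auto simp: bij_betw_def)
  \<comment> \<open>Every row of \<open>R\<close> has its diagonal one in some column of
    \<open>X\<close>, where row \<open>q\<close> vanishes.\<close>
  have "q \<notin> R"
    using r tri zero unfolding bij_betw_def lower_unitriangular_def by auto
  then have "bij_betw (case_nat q r) {..<Suc n} (insert q R)"
    by (rule bij_betw_case_nat[OF r])
  moreover have "bij_betw (case_nat x c) {..<Suc n} (insert x X)"
    using assms(2,3) by (intro bij_betw_case_nat[OF c]) auto
  moreover have "lower_unitriangular (Suc n) (\<lambda>i j. M (case_nat q r i) (case_nat x c j))"
    using tri zero assms(2) unfolding lower_unitriangular_def by (auto split: nat.splits)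
  ultimately show ?thesis
    unfolding congruent_unitriangular_def by blast
qed

text \<open>In triangular form the first row is zero to the right of the diagonal, so it isolates
  the first column; deleting both leaves a triangular block. This drives the inductions over
  representing submatrices.\<close>

lemma congruent_unitriangular_remove:
  assumes "congruent_unitriangular M R X" "X \<noteq> {}"
  obtains q x where "q \<in> R" "x \<in> X" "M q x" "\<forall>y\<in>X - {x}. \<not> M q y"
    "congruent_unitriangular M (R - {q}) (X - {x})"
proof -
  obtain n r c where r: "bij_betw r {..<n} R" and c: "bij_betw c {..<n} X"
    and tri: "lower_unitriangular n (\<lambda>i j. M (r i) (c j))"
    using assms(1) unfolding congruent_unitriangular_def by blast
  have "n \<noteq> 0"
    using c assms(2) by (auto simp: bij_betw_def)
  then obtain l where n: "n = Suc l"
    using not0_implies_Suc by blast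
  have r': "bij_betw (\<lambda>i. r (Suc i)) {..<l} (R - {r 0})"
    and c': "bij_betw (\<lambda>i. c (Suc i)) {..<l} (X - {c 0})"
    using r c bij_betw_Suc_remove unfolding n by blast+
  show thesis
  proof
    show "r 0 \<in> R" "c 0 \<in> X"
      using r c n by (auto simp: bij_betw_def)
    show "M (r 0) (c 0)"
      using tri n by (auto simp: lower_unitriangular_def)
    have "X - {c 0} = (\<lambda>i. c (Suc i)) ` {..<l}"
      using c' by (simp add: bij_betw_def)
    then show "\<forall>y\<in>X - {c 0}. \<not> M (r 0) y"
      using tri n by (auto simp: lower_unitriangular_def)
    have "lower_unitriangular l (\<lambda>i j. M (r (Suc i)) (c (Suc j)))"
      using tri n by (auto simp: lower_unitriangular_def)
    then show "congruent_unitriangular M (R - {r 0}) (X - {c 0})"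
      using r' c' unfolding congruent_unitriangular_def by blast
  qed
qed

section \<open>Separating flats and boolean representability\<close>

lemma boolean_representable_imp_flat:
  assumes "boolean_representable S" "X \<in> faces S" "X \<noteq> {}"
  obtains F x where "is_flat S F" "x \<in> X" "x \<notin> F" "X - {x} \<subseteq> F"
proof -
  obtain m :: nat and M where
    "faces S = {X. X \<subseteq> vertices S \<and> (\<exists>R \<subseteq> {..<m}. congruent_unitriangular M R X)}"
    using assms(1) unfolding boolean_representable_def by blast
  then have H: "X \<in> faces S \<longleftrightarrow>
      X \<subseteq> vertices S \<and> (\<exists>R \<subseteq> {..<m}. congruent_unitriangular M R X)" for X
    by simp
  obtain R where R: "R \<subseteq> {..<m}" "congruent_unitriangular M R X" and XV: "X \<subseteq> vertices S"
    using assms(2) unfolding H by blast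
  obtain q x where q: "q \<in> R" and x: "x \<in> X" "M q x" "\<forall>y\<in>X - {x}. \<not> M q y"
    by (rule congruent_unitriangular_remove[OF R(2) assms(3)])
  define F where "F = {v \<in> vertices S. \<not> M q v}"
  \<comment> \<open>Row \<open>q\<close> vanishes on \<open>I\<close> and is one at
    \<open>p\<close>, so placed first it extends a triangular submatrix for \<open>I\<close> to one
    for \<open>I \<union> {p}\<close>.\<close>
  have "I \<union> {p} \<in> faces S" if I: "I \<in> faces S" "I \<subseteq> F" and p: "p \<in> vertices S - F" for I p
  proof -
    obtain Q where "Q \<subseteq> {..<m}" "congruent_unitriangular M Q I"
      using I(1) unfolding H by blast
    moreover have "M q p" "\<forall>y\<in>I. \<not> M q y"
      using I(2) p unfolding F_def by auto
    ultimately have "insert q Q \<subseteq> {..<m}" "congruent_unitriangular M (insert q Q) (insert p I)"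
      using q R(1) by (auto intro: congruent_unitriangular_insert)
    moreover have "I \<union> {p} \<subseteq> vertices S"
      using I(2) p unfolding F_def by auto
    ultimately show ?thesis
      unfolding H by (intro conjI exI[of _ "insert q Q"]) simp_all
  qed
  moreover have "F \<subseteq> vertices S"
    unfolding F_def by blast
  ultimately have "is_flat S F"
    unfolding is_flat_def by blast
  moreover have "x \<notin> F" "X - {x} \<subseteq> F"
    using x XV unfolding F_def by auto
  ultimately show thesis
    using that x(1) by blast
qed

lemma simplicial_complexD:
  assumes "simplicial_complex S"
  shows "finite (vertices S)"
    and "X \<in> faces S \<Longrightarrow> X \<subseteq> vertices S"
    and "X \<in> faces S \<Longrightarrow> finite X"
    and "X \<in> faces S \<Longrightarrow> Y \<subseteq> X \<Longrightarrow> Y \<in> faces S"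
    and "{} \<in> faces S"
proof -
  show fin: "finite (vertices S)"
    using assms unfolding simplicial_complex_def by (elim conjE)
  have faces: "faces S \<subseteq> Pow (vertices S)"
    using assms unfolding simplicial_complex_def by (elim conjE)
  then show "X \<subseteq> vertices S" if "X \<in> faces S" for X
    using that by auto
  then show "finite X" if "X \<in> faces S" for X
    using that fin finite_subset by metis
  have "\<forall>X\<in>faces S. \<forall>Y. Y \<subseteq> X \<longrightarrow> Y \<in> faces S"
    using assms unfolding simplicial_complex_def by (elim conjE)
  then show down: "Y \<in> faces S" if "X \<in> faces S" "Y \<subseteq> X" for X Y
    using that by simp
  obtain v where "{v} \<in> faces S"
    using assms unfolding simplicial_complex_def by (metis equals0I)
  then show "{} \<in> faces S"
    by (rule down) simp
qed

lemma boolean_representable_if_flat: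
  fixes S :: "'a scomplex"
  assumes S: "simplicial_complex S"
    and flat: "\<And>X. X \<in> faces S \<Longrightarrow> X \<noteq> {} \<Longrightarrow> \<exists>F x. is_flat S F \<and> x \<in> X \<and> x \<notin> F \<and> X - {x} \<subseteq> F"
  shows "boolean_representable S"
proof -
  note fin = simplicial_complexD(1)[OF S]
    and sub = simplicial_complexD(2)[OF S]
    and down = simplicial_complexD(4)[OF S]
  have "finite {F. is_flat S F}"
    by (rule finite_subset[of _ "Pow (vertices S)"]) (auto simp: is_flat_def fin)
  then obtain f :: "nat \<Rightarrow> 'a set" where "bij_betw f {0..<card {F. is_flat S F}} {F. is_flat S F}"
    using ex_bij_betw_nat_finite by blast
  moreover define m where "m = card {F. is_flat S F}"
  ultimately have f: "f ` {..<m} = {F. is_flat S F}"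
    by (simp only: bij_betw_def atLeast0LessThan)
  \<comment> \<open>One row per flat, with that flat as its zero set among the vertices; the
    enumeration \<open>f\<close> supplies numeric row indices.\<close>
  define M where "M i v \<longleftrightarrow> v \<notin> f i" for i v
  \<comment> \<open>A flat splits \<open>x\<close> off from the face; its row is zero on
    \<open>X - {x}\<close> and one at \<open>x\<close>, so it can precede the rows found for
    \<open>X - {x}\<close>.\<close>
  have rep: "\<exists>R\<subseteq>{..<m}. congruent_unitriangular M R X" if "X \<in> faces S" for X
    using finite_subset[OF sub[OF that] fin] that
  proof (induction X rule: finite_remove_induct)
    case empty
    then show ?case using congruent_unitriangular_empty by blast
  next
    case (remove X)
    obtain F x where "is_flat S F" and x: "x \<in> X" "x \<notin> F" "X - {x} \<subseteq> F"
      using flat[OF remove.prems remove.hyps(2)] by blast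
    then have "F \<in> f ` {..<m}"
      unfolding f by blast
    then obtain q where q: "q < m" "f q = F"
      by blast
    obtain R where R: "R \<subseteq> {..<m}" "congruent_unitriangular M R (X - {x})"
      using remove.IH[OF x(1) down[OF remove.prems]] by auto
    have "congruent_unitriangular M (insert q R) (insert x (X - {x}))"
      using x q by (intro congruent_unitriangular_insert[OF R(2)]) (auto simp: M_def)
    then show ?case
      using R(1) q(1) x(1) by (intro exI[of _ "insert q R"]) (auto simp: insert_absorb)
  qed
  \<comment> \<open>Conversely, the first row of the triangular form is a flat containing all
    columns but \<open>x\<close>. Once \<open>X - {x}\<close> is known to be a face, flatness lets
    \<open>x\<close> be added.\<close>
  have "X \<in> faces S"
    if "congruent_unitriangular M R X" "R \<subseteq> {..<m}" "X \<subseteq> vertices S" for R X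
    using congruent_unitriangular_finite[OF that(1)] that
  proof (induction X arbitrary: R rule: finite_remove_induct)
    case empty
    then show ?case using simplicial_complexD(5)[OF S] by blast
  next
    case (remove X)
    obtain q x where q: "q \<in> R" and x: "x \<in> X" "M q x" "\<forall>y\<in>X - {x}. \<not> M q y"
      and "congruent_unitriangular M (R - {q}) (X - {x})"
      using congruent_unitriangular_remove[OF remove.prems(1) remove.hyps(2)] .
    then have "X - {x} \<in> faces S"
      using remove.prems by (intro remove.IH[OF x(1), of "R - {q}"]) auto
    moreover have "is_flat S (f q)"
      using f q remove.prems(2) by blast
    moreover have "X - {x} \<subseteq> f q" "x \<in> vertices S - f q"
      using x remove.prems(3) by (auto simp: M_def)
    ultimately have "X - {x} \<union> {x} \<in> faces S"
      unfolding is_flat_def by blast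
    then show ?case
      using x(1) by (simp add: insert_absorb)
  qed
  then have "{X. X \<subseteq> vertices S \<and> (\<exists>R \<subseteq> {..<m}. congruent_unitriangular M R X)} \<subseteq> faces S"
    by blast
  moreover have "faces S \<subseteq> {X. X \<subseteq> vertices S \<and> (\<exists>R \<subseteq> {..<m}. congruent_unitriangular M R X)}"
    by (intro subsetI CollectI conjI sub rep)
  ultimately have "faces S = {X. X \<subseteq> vertices S \<and> (\<exists>R \<subseteq> {..<m}. congruent_unitriangular M R X)}"
    by (rule equalityI[rotated])
  then show ?thesis
    using S unfolding boolean_representable_def by blast
qed

section \<open>Closures, and the faces inside them in a near-matroid\<close>

lemma flat_closure_subset: "is_flat S F \<Longrightarrow> X \<subseteq> F \<Longrightarrow> flat_closure S X \<subseteq> F"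
  unfolding flat_closure_def by blast

lemma subset_flat_closure: "X \<subseteq> flat_closure S X"
  unfolding flat_closure_def by blast

text \<open>A vertex outside the closure is missed by some flat above \<open>X\<close>, and that
  flat contains every face lying in the closure.\<close>

lemma is_flat_flat_closure:
  assumes "X \<subseteq> vertices S"
  shows "is_flat S (flat_closure S X)"
proof -
  have "is_flat S (vertices S)"
    by (simp add: is_flat_def)
  then have "flat_closure S X \<subseteq> vertices S"
    using assms by (rule flat_closure_subset)
  then show ?thesis
    unfolding is_flat_def flat_closure_def by blast
qed

text \<open>The separating flat may be shrunk to the closure of \<open>X - {x}\<close>, the form to
  which the near-matroid condition applies.\<close>

lemma boolean_representable_imp_closure:
  assumes "boolean_representable S" "X \<in> faces S" "X \<noteq> {}"
  obtains x where "x \<in> X" "x \<notin> flat_closure S (X - {x})"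
  using boolean_representable_imp_flat[OF assms] flat_closure_subset by (metis subsetD)

text \<open>Take \<open>J\<close> maximal among the faces between \<open>I\<close> and the closure
  of \<open>Y\<close>. A point of that closure missing from the closure of \<open>J\<close> could be
  added to \<open>J\<close>, against maximality. So both closures agree, and the near-matroid
  condition fixes the size of \<open>J\<close>.\<close>

lemma near_matroid_extend:
  assumes S: "simplicial_complex S" "near_matroid S"
    and Y: "Y \<in> faces S" "flat_closure S Y \<noteq> vertices S"
    and I: "I \<in> faces S" "I \<subseteq> flat_closure S Y"
  obtains J where "J \<in> faces S" "I \<subseteq> J" "J \<subseteq> flat_closure S Y" "card J = card Y"
proof -
  note fin = simplicial_complexD(1)[OF S(1)]
    and sub = simplicial_complexD(2)[OF S(1)]
  have flat: "is_flat S (flat_closure S Y)"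
    using is_flat_flat_closure[OF sub[OF Y(1)]] .
  let ?A = "{J \<in> faces S. J \<subseteq> flat_closure S Y}"
  have "finite ?A"
    by (rule finite_subset[of ?A "Pow (vertices S)"]) (auto simp: fin dest: sub)
  moreover have "I \<in> ?A"
    using I by simp
  ultimately have "\<exists>J\<in>?A. I \<subseteq> J \<and> (\<forall>K\<in>?A. J \<subseteq> K \<longrightarrow> J = K)"
    by (rule finite_has_maximal2)
  then obtain J where J: "J \<in> faces S" "J \<subseteq> flat_closure S Y" "I \<subseteq> J"
    and max: "\<forall>K\<in>?A. J \<subseteq> K \<longrightarrow> J = K"
    by blast
  have "flat_closure S Y \<subseteq> flat_closure S J"
  proof
    fix p assume p: "p \<in> flat_closure S Y"
    show "p \<in> flat_closure S J"
    proof (rule ccontr)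
      assume np: "p \<notin> flat_closure S J"
      have "is_flat S (flat_closure S J)"
        using is_flat_flat_closure[OF sub[OF J(1)]] .
      moreover have "p \<in> vertices S"
        using p flat unfolding is_flat_def by blast
      ultimately have "J \<union> {p} \<in> faces S"
        using J(1) np subset_flat_closure[of J S] unfolding is_flat_def by blast
      then have "J \<union> {p} = J"
        using max J(2) p by blast
      then show False
        using np subset_flat_closure[of J S] by blast
    qed
  qed
  moreover have "flat_closure S J \<subseteq> flat_closure S Y"
    using flat_closure_subset[OF flat J(2)] .
  ultimately have "flat_closure S J = flat_closure S Y"
    by (rule equalityI[rotated])
  moreover have "flat_closure S Y \<subset> vertices S"
    using flat Y(2) unfolding is_flat_def by blast
  ultimately have "card J = card Y"
    using S(2) Y(1) J(1) unfolding near_matroid_def by metis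
  then show thesis
    using that J by blast
qed

section \<open>Truncations\<close>

lemma simplicial_complex_truncation:
  assumes "simplicial_complex S" "k \<ge> 1"
  shows "simplicial_complex (truncation k S)"
proof -
  have "card Y \<le> k" if "X \<subseteq> vertices S" "card X \<le> k" "Y \<subseteq> X" for X Y
  proof -
    have "finite X"
      using finite_subset[OF that(1)] simplicial_complexD(1)[OF assms(1)] by blast
    then show ?thesis
      using card_mono[of X Y] that by simp
  qed
  then show ?thesis
    using assms unfolding simplicial_complex_def truncation_def subsets_le_def by auto
qed

lemma boolean_representable_truncation:
  assumes S: "boolean_representable S" "near_matroid S" and k: "k \<ge> 1"
  shows "boolean_representable (truncation k S)"
proof (rule boolean_representable_if_flat)
  have SC: "simplicial_complex S"
    using S(1) unfolding boolean_representable_def by blast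
  then show "simplicial_complex (truncation k S)"
    using k by (rule simplicial_complex_truncation)
  note fin = simplicial_complexD(3)[OF SC]
    and sub = simplicial_complexD(2)[OF SC]
    and down = simplicial_complexD(4)[OF SC]
  fix X assume "X \<in> faces (truncation k S)" and ne: "X \<noteq> {}"
  then have X: "X \<in> faces S" "card X \<le> k"
    by (auto simp: truncation_def subsets_le_def)
  obtain x where x: "x \<in> X" "x \<notin> flat_closure S (X - {x})"
    using boolean_representable_imp_closure[OF S(1) X(1) ne] .
  let ?F = "flat_closure S (X - {x})"
  have Y: "X - {x} \<in> faces S"
    using down[OF X(1)] by blast
  have proper: "?F \<noteq> vertices S"
    using x sub[OF X(1)] by blast
  have F: "is_flat S ?F"
    using is_flat_flat_closure[OF sub[OF Y]] .
  \<comment> \<open>Faces inside \<open>?F\<close> have at most \<open>card X - 1\<close> elements,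
    so one more element keeps them within \<open>k\<close>.\<close>
  have card: "card (I \<union> {p}) \<le> k" if I: "I \<in> faces S" "I \<subseteq> ?F" for I p
  proof -
    obtain J where J: "J \<in> faces S" "I \<subseteq> J" "J \<subseteq> ?F" "card J = card (X - {x})"
      using near_matroid_extend[OF SC S(2) Y proper I] .
    have "card I \<le> card (X - {x})"
      using card_mono[OF fin[OF J(1)] J(2)] J(4) by simp
    moreover have "Suc (card (X - {x})) = card X"
      using card_Suc_Diff1[OF fin[OF X(1)] x(1)] .
    ultimately show ?thesis
      using X(2) card_insert_le_m1[of k I p] k by simp
  qed
  have "is_flat (truncation k S) ?F"
    unfolding is_flat_def
  proof (intro conjI ballI)
    show "?F \<subseteq> vertices (truncation k S)"
      using F unfolding is_flat_def truncation_def by simp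
  next
    fix I p assume "I \<in> faces (truncation k S) \<inter> Pow ?F" "p \<in> vertices (truncation k S) - ?F"
    then have I: "I \<in> faces S" "I \<subseteq> ?F" and p: "p \<in> vertices S - ?F"
      by (auto simp: truncation_def)
    then have "I \<union> {p} \<in> faces S"
      using F unfolding is_flat_def by blast
    then show "I \<union> {p} \<in> faces (truncation k S)"
      using card[OF I, of p] I(1) p sub[of I] unfolding truncation_def subsets_le_def by simp
  qed
  then show "\<exists>F x. is_flat (truncation k S) F \<and> x \<in> X \<and> x \<notin> F \<and> X - {x} \<subseteq> F"
    using x subset_flat_closure[of "X - {x}" S] by blast
qed

section \<open>Pure cores\<close>

lemma near_matroid_extend_insert:
  assumes S: "simplicial_complex S" "near_matroid S"
    and Y: "Y \<in> faces S" "flat_closure S Y \<noteq> vertices S"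
    and F: "is_flat S F" "F \<subseteq> flat_closure S Y"
    and I: "I \<in> faces S" "I \<subseteq> F" and p: "p \<in> vertices S - F"
  obtains K where "K \<in> faces S" "I \<union> {p} \<subseteq> K" "card K = Suc (card Y)"
proof -
  note fin = simplicial_complexD(3)[OF S(1)]
    and sub = simplicial_complexD(2)[OF S(1)]
  let ?G = "flat_closure S Y"
  have G: "is_flat S ?G"
    using is_flat_flat_closure[OF sub[OF Y(1)]] .
  \<comment> \<open>Here \<open>J\<close> grows inside \<open>?G\<close> to the size of
    \<open>Y\<close>, and \<open>q\<close> is added last. The point \<open>p\<close> may be absorbed
    by \<open>J\<close> (when it lies in \<open>?G\<close>) or serve as \<open>q\<close>
    itself.\<close>
  have step: "\<exists>K\<in>faces S. I \<union> {p} \<subseteq> K \<and> card K = Suc (card Y)"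
    if J: "J \<in> faces S" "J \<subseteq> ?G" and q: "q \<in> vertices S - ?G"
    and IJ: "I \<union> {p} \<subseteq> J \<union> {q}" for J q
  proof -
    obtain K where K: "K \<in> faces S" "J \<subseteq> K" "K \<subseteq> ?G" "card K = card Y"
      using near_matroid_extend[OF S Y J] .
    have "K \<union> {q} \<in> faces S"
      using G K(1,3) q unfolding is_flat_def by blast
    moreover have "card (K \<union> {q}) = Suc (card Y)"
    proof -
      have "q \<notin> K"
        using K(3) q by blast
      then show ?thesis
        using fin[OF K(1)] K(4) by simp
    qed
    moreover have "I \<union> {p} \<subseteq> K \<union> {q}"
      using K(2) IJ by blast
    ultimately show ?thesis
      by (intro bexI[of _ "K \<union> {q}"] conjI)
  qed
  have "\<exists>K\<in>faces S. I \<union> {p} \<subseteq> K \<and> card K = Suc (card Y)"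
  proof (cases "p \<in> ?G")
    case True
    have "I \<union> {p} \<in> faces S"
      using F(1) I p unfolding is_flat_def by blast
    moreover have "I \<union> {p} \<subseteq> ?G"
      using True I(2) F(2) by blast
    moreover obtain q where "q \<in> vertices S - ?G"
      using G Y(2) unfolding is_flat_def by blast
    ultimately show ?thesis
      by (rule step) blast
  next
    case False
    then show ?thesis
      using step[OF I(1) subset_trans[OF I(2) F(2)], of p] p by simp
  qed
  then obtain K where "K \<in> faces S" "I \<union> {p} \<subseteq> K" "card K = Suc (card Y)"
    by blast
  then show thesis
    by (rule that)
qed

lemma max_face:
  assumes "simplicial_complex S"
  obtains B where "B \<in> faces S" "card B = dimension S + 1"
proof -
  have fin: "finite (faces S)"
    by (rule finite_subset[of "faces S" "Pow (vertices S)"])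
      (use simplicial_complexD(1,2)[OF assms] in auto)
  obtain v where v: "{v} \<in> faces S"
    using assms unfolding simplicial_complex_def by (metis equals0I)
  have "Max (card ` faces S) \<in> card ` faces S"
    using fin v by (intro Max_in) auto
  \<comment> \<open>The maximum is at least 1, so adding 1 undoes the natural subtraction in
    \<open>dimension\<close>.\<close>
  moreover have "Max (card ` faces S) \<ge> card {v}"
    using fin v by (intro Max_ge finite_imageI imageI)
  ultimately show thesis
    using that unfolding dimension_def by fastforce
qed

lemma faces_pure_core:
  assumes "simplicial_complex S"
  shows "X \<in> faces (pure_core S) \<longleftrightarrow> (\<exists>B\<in>faces S. card B = dimension S + 1 \<and> X \<subseteq> B)"
  using simplicial_complexD(2)[OF assms] unfolding pure_core_def subsets_eq_def Let_def by auto

lemma vertices_pure_core: "vertices (pure_core S) = \<Union> (faces (pure_core S))"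
  unfolding pure_core_def Let_def by auto

lemma simplicial_complex_pure_core:
  assumes "simplicial_complex S"
  shows "simplicial_complex (pure_core S)"
proof -
  note P = faces_pure_core[OF assms]
  obtain B where B: "B \<in> faces S" "card B = dimension S + 1"
    using max_face[OF assms] .
  then have "B \<noteq> {}" "B \<in> faces (pure_core S)"
    using P by auto
  then have "vertices (pure_core S) \<noteq> {}"
    unfolding vertices_pure_core by blast
  moreover have "vertices (pure_core S) \<subseteq> vertices S"
    unfolding vertices_pure_core
  proof (rule Union_least)
    fix X assume "X \<in> faces (pure_core S)"
    then obtain B where B: "B \<in> faces S" "X \<subseteq> B"
      unfolding P by blast
    then show "X \<subseteq> vertices S"
      using simplicial_complexD(2)[OF assms B(1)] by blast
  qed
  then have "finite (vertices (pure_core S))"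
    using simplicial_complexD(1)[OF assms] by (rule finite_subset)
  moreover have "{v} \<in> faces (pure_core S)" if "v \<in> vertices (pure_core S)" for v
    using that unfolding vertices_pure_core Union_iff Bex_def P by blast
  moreover have "Y \<in> faces (pure_core S)" if "X \<in> faces (pure_core S)" "Y \<subseteq> X" for X Y
    using that unfolding P by blast
  ultimately show ?thesis
    unfolding simplicial_complex_def vertices_pure_core by auto
qed

lemma boolean_representable_pure_core_truncation:
  assumes S: "boolean_representable S" "near_matroid S" and k: "k \<ge> 1"
  shows "boolean_representable (pure_core (truncation k S))" (is "boolean_representable ?P")
proof (rule boolean_representable_if_flat)
  have SC: "simplicial_complex S"
    using S(1) unfolding boolean_representable_def by blast
  have TC: "simplicial_complex (truncation k S)"
    using SC k by (rule simplicial_complex_truncation)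
  then show "simplicial_complex ?P"
    by (rule simplicial_complex_pure_core)
  note fin = simplicial_complexD(3)[OF SC]
    and sub = simplicial_complexD(2)[OF SC]
    and down = simplicial_complexD(4)[OF SC]
  define m where "m = dimension (truncation k S) + 1"
  have mk: "m \<le> k"
    using max_face[OF TC] unfolding m_def truncation_def subsets_le_def by fastforce
  \<comment> \<open>As \<open>m \<le> k\<close>, the faces of size \<open>m\<close> are the same in
    \<open>S\<close> and in its truncation, so the pure core can be described by faces of
    \<open>S\<close>.\<close>
  have P: "X \<in> faces ?P \<longleftrightarrow> (\<exists>B\<in>faces S. card B = m \<and> X \<subseteq> B)" for X
    using mk sub unfolding faces_pure_core[OF TC] m_def[symmetric]
    by (auto simp: truncation_def subsets_le_def)
  have PV: "v \<in> vertices ?P \<longleftrightarrow> (\<exists>B\<in>faces S. card B = m \<and> v \<in> B)" for v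
    unfolding vertices_pure_core Union_iff Bex_def P by blast
  fix X assume XP: "X \<in> faces ?P" and ne: "X \<noteq> {}"
  then obtain B where B: "B \<in> faces S" "card B = m" "X \<subseteq> B"
    unfolding P by blast
  then have X: "X \<in> faces S"
    using down by metis
  \<comment> \<open>The element is split off from the face \<open>B\<close> of size \<open>m\<close>
    rather than from \<open>X\<close>: then \<open>?G\<close> is a proper flat spanned by a face of
    size \<open>m - 1\<close>, and extensions through it reach size exactly
    \<open>m\<close>.\<close>
  obtain b where b: "b \<in> B" "b \<notin> flat_closure S (B - {b})"
    using boolean_representable_imp_closure[OF S(1) B(1)] B(3) ne by (metis subset_empty)
  let ?G = "flat_closure S (B - {b})"
  have Y: "B - {b} \<in> faces S" and proper: "?G \<noteq> vertices S"
    using down[OF B(1)] b sub[OF B(1)] by blast+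
  have cardY: "Suc (card (B - {b})) = m"
    using card_Suc_Diff1[OF fin[OF B(1)] b(1)] B(2) by simp
  have G: "is_flat S ?G"
    using is_flat_flat_closure[OF sub[OF Y]] .
  \<comment> \<open>If \<open>b \<in> X\<close>, then \<open>?G\<close> itself separates
    \<open>b\<close> from the rest of \<open>X\<close>. Otherwise \<open>X\<close> lies in
    \<open>?G\<close>, and so does the closure of \<open>X - {x}\<close> for a suitable
    \<open>x\<close>.\<close>
  have "\<exists>F x. is_flat S F \<and> F \<subseteq> ?G \<and> x \<in> X \<and> x \<notin> F \<and> X - {x} \<subseteq> F"
  proof (cases "b \<in> X")
    case True
    then show ?thesis
      using G b B(3) subset_flat_closure[of "B - {b}" S] by blast
  next
    case False
    then have XG: "X \<subseteq> ?G"
      using B(3) subset_flat_closure[of "B - {b}" S] by blast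
    obtain x where x: "x \<in> X" "x \<notin> flat_closure S (X - {x})"
      using boolean_representable_imp_closure[OF S(1) X ne] .
    have "X - {x} \<subseteq> vertices S" "X - {x} \<subseteq> ?G"
      using sub[OF X] XG by blast+
    then have "is_flat S (flat_closure S (X - {x}))" "flat_closure S (X - {x}) \<subseteq> ?G"
      using is_flat_flat_closure flat_closure_subset[OF G] by metis+
    then show ?thesis
      using x subset_flat_closure[of "X - {x}" S] by blast
  qed
  then obtain F x where F: "is_flat S F" "F \<subseteq> ?G" and x: "x \<in> X" "x \<notin> F" "X - {x} \<subseteq> F"
    by blast
  \<comment> \<open>The pure core may have fewer vertices than \<open>S\<close>, hence the
    intersection.\<close>
  have "is_flat ?P (F \<inter> vertices ?P)"
    unfolding is_flat_def
  proof (intro conjI ballI)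
    fix I p assume I: "I \<in> faces ?P \<inter> Pow (F \<inter> vertices ?P)"
      and p: "p \<in> vertices ?P - F \<inter> vertices ?P"
    have "I \<in> faces S"
      using I down unfolding P Int_iff by metis
    moreover have "I \<subseteq> F"
      using I by blast
    moreover have "p \<in> vertices S - F"
      using p sub unfolding Diff_iff Int_iff PV by blast
    ultimately obtain K where "K \<in> faces S" "I \<union> {p} \<subseteq> K" "card K = m"
      using near_matroid_extend_insert[OF SC S(2) Y proper F] cardY by metis
    then show "I \<union> {p} \<in> faces ?P"
      unfolding P by blast
  qed simp
  moreover have "X \<subseteq> vertices ?P"
    using XP unfolding vertices_pure_core by blast
  ultimately show "\<exists>F x. is_flat ?P F \<and> x \<in> X \<and> x \<notin> F \<and> X - {x} \<subseteq> F"
    using x by blast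
qed

theorem theorem7p9:
  fixes S :: "'a scomplex" and k :: nat
  assumes "simplicial_complex S"
    and "boolean_representable S"
    and "near_matroid S"
    and "k \<ge> 1"
  shows "boolean_representable (truncation k S) \<and>
         boolean_representable (pure_core (truncation k S))"
  using assms boolean_representable_truncation boolean_representable_pure_core_truncation by blast

end
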